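(* Let $n,k$ be positive integers and let $f$ be a lower semi-continuous function mapping to $[-\infty,\infty]$, defined on real $n\times n$ matrices, with non-empty domain over the set of positive semidefinite matrices. Consider the problem $$\text{(A)}\qquad \min_{X\succeq 0}\ f(X)\quad\text{such that}\quad \operatorname{rank}(X)\le k,$$ where $X\in\mathbb{R}^{n\times n}$ is a (symmetric) positive semidefinite real matrix. Using the change of variable $X=PP^T$ with $P\in\mathbb{R}^{n\times k}$, consider the problem $$\text{(B)}\qquad \min_{P\in\mathbb{R}^{n\times k}}\ g(P):=f(PP^T).$$ Let $\bar P\in\mathbb{R}^{n\times k}$ and $\bar X=\bar P\bar P^T$, where $\bar X$ is feasible for (A). Then $\bar X$ is a local minimizer of (A) if and only if $\bar P$ is a local minimizer of (B).
   Context: $X\succeq 0$ means that $X$ is symmetric positive semidefinite. The function $f$ is extended-valued, so it may encode additional constraints. A local minimizer of a problem is a feasible point for which there is some $\epsilon>0$ such that no feasible point within distance $\epsilon$ has a strictly smaller objective value. For (A), the feasible set is the set of positive semidefinite matrices of rank at most $k$; for (B), it is all of $\mathbb{R}^{n\times k}$. *)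

theory Defs
  imports "HOL-Analysis.Analysis"
begin

definition psd :: "real ^ 'n ^ 'n \<Rightarrow> bool" where
  "psd X \<longleftrightarrow> transpose X = X \<and> (\<forall>v. 0 \<le> v \<bullet> (X *v v))"

definition lower_semicontinuous :: "('a::topological_space \<Rightarrow> ereal) \<Rightarrow> bool" where
  "lower_semicontinuous f \<longleftrightarrow> (\<forall>x. f x \<le> Liminf (at x) f)"

(* Points of S at which h takes the value \<infinity> are feasible: S alone determines feasibility. *)
definition local_minimizer :: "'a::metric_space set \<Rightarrow> ('a \<Rightarrow> ereal) \<Rightarrow> 'a \<Rightarrow> bool" where
  "local_minimizer S h x \<longleftrightarrow>
     x \<in> S \<and> (\<exists>\<epsilon>>0. \<not> (\<exists>y\<in>S. dist x y \<le> \<epsilon> \<and> h y < h x))"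

(* On real ^ 'n ^ 'm the library distance is the one induced by the Frobenius norm. *)

definition feasible_A :: "nat \<Rightarrow> (real ^ 'n ^ 'n) set" where
  "feasible_A k = {X. psd X \<and> rank X \<le> k}"

definition objective_B :: "(real ^ 'n ^ 'n \<Rightarrow> ereal) \<Rightarrow> real ^ 'k ^ 'n \<Rightarrow> ereal" where
  "objective_B f P = f (P ** transpose P)"

end

theory Submission
  imports Defs
begin

text \<open>
  Every feasible point of (A) has the form \<open>P P\<^sup>T\<close> with \<open>P\<close> of size \<open>n \<times> k\<close>, so (A) and (B) range
  over the same objective values; the theorem says that the map \<open>P \<mapsto> P P\<^sup>T\<close> also preserves
  nearness well enough. One direction is its continuity: matrices near \<open>Pbar\<close> are sent to feasible
  matrices near \<open>Xbar\<close>, so a local minimizer \<open>Xbar\<close> forces one at \<open>Pbar\<close>.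

  The converse is a lifting property (\<open>gram_sequence_lift\<close>): if feasible matrices \<open>X m\<close> tend to
  \<open>Pbar Pbar\<^sup>T\<close>, then along a subsequence they have factors tending to the prescribed \<open>Pbar\<close>.
  Arbitrary factors \<open>Q m\<close> of the \<open>X m\<close> exist (\<open>psd_low_rank_factorization\<close>) and are bounded,
  because the squared norms of their rows are diagonal entries of \<open>X m\<close>. Hence a subsequence converges
  to some \<open>L\<close>, and by continuity \<open>L L\<^sup>T = Pbar Pbar\<^sup>T\<close>. The limit may differ from \<open>Pbar\<close>, but
  two factors of the same matrix differ by an orthogonal matrix, \<open>Pbar = L M\<close>
  (\<open>gram_eq_imp_orthogonal_factor\<close>). As \<open>Q m M\<close> is again a factor of \<open>X m\<close>, the whole sequence can be
  rotated by the one matrix \<open>M\<close>, and the rotated factors tend to \<open>L M = Pbar\<close>. Feasible points near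
  \<open>Xbar\<close> with a smaller objective value would thus give points near \<open>Pbar\<close> with that same value.
\<close>

section \<open>Factoring positive semidefinite matrices of bounded rank\<close>

lemma symmetric_matrix_inner:
  fixes X :: "real ^ 'n ^ 'n"
  assumes "transpose X = X"
  shows "(X *v u) \<bullet> v = u \<bullet> (X *v v)"
  by (metis assms dot_lmul_matrix transpose_matrix_vector)

text \<open>
  Polarization: a symmetric bilinear form is determined by its quadratic form.
\<close>

lemma psd_eq_zero_if_form_zero:
  fixes X :: "real ^ 'n ^ 'n"
  assumes "transpose X = X" and zero: "\<And>v. v \<bullet> (X *v v) = 0"
  shows "X = 0"
proof -
  have "u \<bullet> (X *v v) = 0" for u v
  proof -
    have "v \<bullet> (X *v u) = u \<bullet> (X *v v)"
      using symmetric_matrix_inner[OF assms(1), of u v] by (simp add: inner_commute)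
    then show ?thesis
      using zero[of "u + v"] zero[of u] zero[of v]
      by (simp add: matrix_vector_right_distrib inner_add_left inner_add_right)
  qed
  then have "X *v v = 0" for v
    by (metis inner_eq_zero_iff)
  then show ?thesis
    by (simp add: matrix_eq)
qed

definition outer_square :: "real ^ 'n \<Rightarrow> real ^ 'n ^ 'n" where
  "outer_square w = (\<chi> i j. w $ i * w $ j)"

lemma outer_square_mult_vector: "outer_square w *v x = (w \<bullet> x) *\<^sub>R w"
  by (simp add: vec_eq_iff outer_square_def matrix_vector_mult_def inner_vec_def
      sum_distrib_left sum_distrib_right mult_ac)

lemma transpose_outer_square: "transpose (outer_square w) = outer_square w"
  by (simp add: outer_square_def transpose_def vec_eq_iff mult.commute)

text \<open>
  A Cholesky step. If \<open>c = v \<bullet> X v > 0\<close>, subtracting the square of \<open>w = X v / sqrt c\<close> leaves a form that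
  is nonnegative by the Cauchy--Schwarz inequality for \<open>X\<close>, and that annihilates \<open>v\<close>. The range of the
  remainder lies in that of \<open>X\<close> and is orthogonal to \<open>v\<close>, so it misses \<open>X v\<close>: the rank drops.
\<close>

lemma psd_peel_outer_square:
  fixes X :: "real ^ 'n ^ 'n"
  assumes "psd X" and "X \<noteq> 0"
  obtains w where "psd (X - outer_square w)" and "rank (X - outer_square w) < rank X"
proof -
  have sym: "transpose X = X" and nonneg: "\<And>v. 0 \<le> v \<bullet> (X *v v)"
    using assms(1) by (auto simp: psd_def)
  obtain v where "v \<bullet> (X *v v) \<noteq> 0"
    using psd_eq_zero_if_form_zero[OF sym] assms(2) by blast
  then have c_pos: "v \<bullet> (X *v v) > 0"
    using nonneg[of v] by linarith
  define c where "c = v \<bullet> (X *v v)"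
  define w where "w = (1 / sqrt c) *\<^sub>R (X *v v)"
  define Y where "Y = X - outer_square w"
  have c: "c > 0" using c_pos by (simp add: c_def)
  have Y_mult: "Y *v x = X *v x - ((x \<bullet> (X *v v)) / c) *\<^sub>R (X *v v)" for x
    using c by (simp add: Y_def matrix_vector_mult_diff_rdistrib outer_square_mult_vector w_def
        inner_commute)
  have Y_sym: "transpose Y = Y"
    using sym transpose_outer_square[of w]
    by (simp add: Y_def transpose_def vec_eq_iff)
  have "0 \<le> x \<bullet> (Y *v x)" for x
  proof -
    define t where "t = (x \<bullet> (X *v v)) / c"
    have vx: "v \<bullet> (X *v x) = x \<bullet> (X *v v)"
      using symmetric_matrix_inner[OF sym, of x v] by (simp add: inner_commute)
    have t: "x \<bullet> (X *v v) = t * c"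
      using c by (simp add: t_def)
    \<comment> \<open>this \<open>t\<close> minimizes the form \<open>X\<close> along the line \<open>x - t v\<close>\<close>
    have "0 \<le> (x - t *\<^sub>R v) \<bullet> (X *v (x - t *\<^sub>R v))"
      by (rule nonneg)
    also have "\<dots> = x \<bullet> (X *v x) - t * (t * c)"
      by (simp add: matrix_vector_mult_diff_distrib matrix_vector_mult_scaleR
          inner_diff_left inner_diff_right vx t flip: c_def)
    also have "\<dots> = x \<bullet> (Y *v x)"
      using c by (simp add: Y_mult inner_diff_right t)
    finally show ?thesis .
  qed
  then have "psd Y"
    using Y_sym by (simp add: psd_def)
  have Y_v: "Y *v v = 0"
    using c by (simp add: Y_mult flip: c_def)
  have "range (\<lambda>x. Y *v x) \<subseteq> range (\<lambda>x. X *v x)"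
  proof
    fix y assume "y \<in> range (\<lambda>x. Y *v x)"
    then obtain x where "y = Y *v x" by blast
    then have "y = X *v (x - ((x \<bullet> (X *v v)) / c) *\<^sub>R v)"
      by (simp add: Y_mult matrix_vector_mult_diff_distrib matrix_vector_mult_scaleR)
    then show "y \<in> range (\<lambda>x. X *v x)" by blast
  qed
  moreover have "X *v v \<notin> range (\<lambda>x. Y *v x)"
  proof
    assume "X *v v \<in> range (\<lambda>x. Y *v x)"
    then obtain x where "X *v v = Y *v x" by blast
    then have "v \<bullet> (X *v v) = (Y *v v) \<bullet> x"
      using symmetric_matrix_inner[OF Y_sym, of v x] by simp
    then show False
      using c_pos Y_v by simp
  qed
  ultimately have "range (\<lambda>x. Y *v x) \<subset> range (\<lambda>x. X *v x)"
    by blast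
  moreover have "span (range (\<lambda>x. Z *v x)) = range (\<lambda>x. Z *v x)" for Z :: "real ^ 'n ^ 'n"
    using linear_subspace_image[OF matrix_vector_mul_linear subspace_UNIV] by (simp add: span_eq_iff)
  ultimately have "rank Y < rank X"
    unfolding rank_dim_range by (intro dim_psubset) (simp only:)
  with \<open>psd Y\<close> show thesis
    using that unfolding Y_def by blast
qed

text \<open>
  Repeated peeling; the index set is arbitrary so that the summands can be labelled directly by the
  columns of the factor. When the rank is smaller than the number of labels, the form becomes zero
  early and the remaining squares are squares of \<open>0\<close>.
\<close>

lemma psd_sum_outer_squares:
  fixes X :: "real ^ 'n ^ 'n"
  assumes "finite I" and "psd X" and "rank X \<le> card I"
  shows "\<exists>w. X = (\<Sum>l\<in>I. outer_square (w l))"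
  using assms
proof (induction I arbitrary: X rule: finite_induct)
  case empty
  have "X = 0"
  proof (rule ccontr)
    assume "X \<noteq> 0"
    then obtain w where "rank (X - outer_square w) < rank X"
      using psd_peel_outer_square empty.prems(1) by blast
    with empty.prems(2) show False by simp
  qed
  then show ?case by simp
next
  case (insert a I)
  obtain u where u: "psd (X - outer_square u)" "rank (X - outer_square u) \<le> card I"
  proof (cases "X = 0")
    case True
    have "outer_square (0 :: real ^ 'n) = 0"
      by (simp add: outer_square_def vec_eq_iff)
    then show thesis
      using that[of 0] True insert.prems(1) by (simp add: rank_eq_0)
  next
    case False
    then obtain u where "psd (X - outer_square u)" "rank (X - outer_square u) < rank X"
      using psd_peel_outer_square insert.prems(1) by blast
    then show thesis
      using that[of u] insert by simp
  qed
  obtain w where w: "X - outer_square u = (\<Sum>l\<in>I. outer_square (w l))"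
    using insert.IH[OF u] by blast
  have "(\<Sum>l\<in>I. outer_square ((w(a := u)) l)) = (\<Sum>l\<in>I. outer_square (w l))"
    using insert.hyps by (intro sum.cong) auto
  then have "X = (\<Sum>l\<in>insert a I. outer_square ((w(a := u)) l))"
    using insert.hyps w by (simp add: algebra_simps)
  then show ?case by blast
qed

lemma psd_low_rank_factorization:
  fixes X :: "real ^ 'n ^ 'n"
  assumes "X \<in> feasible_A CARD('k)"
  obtains P :: "real ^ 'k ^ 'n" where "P ** transpose P = X"
proof -
  obtain w :: "'k \<Rightarrow> real ^ 'n" where w: "X = (\<Sum>l\<in>UNIV. outer_square (w l))"
    using psd_sum_outer_squares[of "UNIV :: 'k set" X] assms by (auto simp: feasible_A_def)
  have "(\<chi> i l. w l $ i) ** transpose (\<chi> i l. w l $ i) = X"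
    by (simp add: w vec_eq_iff matrix_matrix_mult_def transpose_def outer_square_def)
  then show thesis by (rule that)
qed

lemma gram_feasible:
  fixes P :: "real ^ 'k ^ 'n"
  shows "P ** transpose P \<in> feasible_A CARD('k)"
proof -
  have "v \<bullet> ((P ** transpose P) *v v) = (transpose P *v v) \<bullet> (transpose P *v v)" for v
    by (metis dot_lmul_matrix matrix_vector_mul_assoc transpose_matrix_vector)
  then have "psd (P ** transpose P)"
    by (simp add: psd_def matrix_transpose_mul del: transpose_matrix_vector)
  moreover have "rank (P ** transpose P) \<le> CARD('k)"
    using rank_mul_le_left[of P "transpose P"] rank_bound[of P] by simp
  ultimately show ?thesis
    by (simp add: feasible_A_def)
qed

section \<open>Factors of the same matrix differ by an orthogonal matrix\<close>

text \<open>
  Equality of norms makes \<open>B\<close> vanish on the kernel of \<open>A\<close>, so \<open>A v \<mapsto> B v\<close> is well defined: compose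
  \<open>B\<close> with any linear section of \<open>A\<close> over its range.
\<close>

lemma linear_factor_through_equinorm:
  fixes A B :: "'a::euclidean_space \<Rightarrow> 'b::euclidean_space"
  assumes "linear A" "linear B" and eq: "\<And>v. norm (A v) = norm (B v)"
  obtains h :: "'b \<Rightarrow> 'b" where "linear h" and "\<And>v. h (A v) = B v"
proof -
  obtain g where g: "linear g" "\<And>y. y \<in> range A \<Longrightarrow> A (g y) = y"
    using linear_exists_right_inverse_on[OF assms(1) subspace_UNIV] by blast
  have "(B \<circ> g) (A v) = B v" for v
  proof -
    have "norm (B (g (A v) - v)) = norm (A (g (A v) - v))"
      by (simp add: eq)
    also have "\<dots> = 0"
      by (simp add: linear_diff[OF assms(1)] g(2))
    finally show ?thesis
      by (simp add: linear_diff[OF assms(2)])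
  qed
  then show thesis
    using that linear_compose[OF g(1) assms(2)] by blast
qed

text \<open>
  The isometry \<open>A v \<mapsto> B v\<close> between the ranges extends to the whole space by adding any isometry \<open>j\<close>
  between their orthogonal complements, which have equal dimension. Instead of splitting a vector by
  projections, the pairs \<open>(v, w)\<close> with \<open>w\<close> orthogonal to the range of \<open>A\<close> parametrize the space by
  \<open>A' (v, w) = A v + w\<close>; with \<open>B' (v, w) = B v + j w\<close>, Pythagoras gives \<open>A'\<close> and \<open>B'\<close> equal norms, and
  the required map is the one that sends \<open>A' x\<close> to \<open>B' x\<close>.
\<close>

lemma orthogonal_extension:
  fixes A B :: "'a::euclidean_space \<Rightarrow> 'b::euclidean_space"
  assumes A: "linear A" and B: "linear B" and eq: "\<And>v. norm (A v) = norm (B v)"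
  obtains U :: "'b \<Rightarrow> 'b" where "orthogonal_transformation U" and "\<And>v. U (A v) = B v"
proof -
  have dim_le: "dim (range D) \<le> dim (range C)"
    if CD: "linear C" "linear D" "\<And>v. norm (C v) = norm (D v)" for C D :: "'a \<Rightarrow> 'b"
  proof -
    obtain h where h: "linear h" "\<And>v. h (C v) = D v"
      using linear_factor_through_equinorm[OF CD] by blast
    have "range D = h ` range C"
      by (simp only: image_image h(2))
    then show ?thesis
      using dim_image_le[OF h(1), of "range C"] by (simp only:)
  qed
  have dim_range: "dim (range A) = dim (range B)"
    using dim_le[OF A B eq] dim_le[OF B A] eq by (simp add: antisym)
  have dim_perp: "dim ((range C)\<^sup>\<bottom>) + dim (range C) = DIM('b)" if "linear C" for C :: "'a \<Rightarrow> 'b"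
    using dim_subspace_orthogonal_to_vectors[of "range C" UNIV]
    by (simp add: orthogonal_comp_def linear_subspace_image[OF that])
  have dim_comp: "dim ((range A)\<^sup>\<bottom>) = dim ((range B)\<^sup>\<bottom>)"
    using dim_perp[OF A] dim_perp[OF B] dim_range by linarith
  obtain j where j: "linear j" "j ` ((range A)\<^sup>\<bottom>) = (range B)\<^sup>\<bottom>"
      "\<And>x. x \<in> (range A)\<^sup>\<bottom> \<Longrightarrow> norm (j x) = norm x"
    by (rule isometry_subspaces[OF subspace_orthogonal_comp subspace_orthogonal_comp dim_comp])
      (rule that)
  define V where "V = (UNIV :: 'a set) \<times> ((range A)\<^sup>\<bottom>)"
  define A' where "A' = (\<lambda>(v, w). A v + w)"
  define B' where "B' = (\<lambda>(v, w). B v + j w)"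
  have V: "subspace V"
    unfolding V_def by (intro subspace_Times subspace_UNIV subspace_orthogonal_comp)
  have A': "linear A'"
    by (rule linearI) (auto simp: A'_def linear_add[OF A] linear_scale[OF A] algebra_simps)
  have B': "linear B'"
    by (rule linearI) (auto simp: B'_def linear_add[OF B] linear_scale[OF B]
        linear_add[OF j(1)] linear_scale[OF j(1)] algebra_simps)
  have norm_eq: "norm (A' x) = norm (B' x)" if "x \<in> V" for x
  proof -
    obtain v w where x: "x = (v, w)" by force
    then have w: "w \<in> (range A)\<^sup>\<bottom>"
      using that by (simp add: V_def)
    then have jw: "j w \<in> (range B)\<^sup>\<bottom>"
      using j(2) by blast
    have "orthogonal (A v) w" "orthogonal (B v) (j w)"
      using w jw by (auto simp: orthogonal_comp_def)
    then have "(norm (A v + w))\<^sup>2 = (norm (B v + j w))\<^sup>2"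
      by (simp add: norm_add_Pythagorean eq j(3)[OF w])
    then show ?thesis
      by (simp add: x A'_def B'_def)
  qed
  have surj: "A' ` V = UNIV"
  proof -
    have "y \<in> A' ` V" for y
    proof -
      have "y \<in> range A + ((range A)\<^sup>\<bottom>)"
        using subspace_sum_orthogonal_comp[OF linear_subspace_image[OF A subspace_UNIV]] by simp
      then obtain v w where "y = A v + w" "w \<in> (range A)\<^sup>\<bottom>"
        by (auto elim!: set_plus_elim)
      then show ?thesis
        by (force simp: A'_def V_def)
    qed
    then show ?thesis by blast
  qed
  \<comment> \<open>a linear section of \<open>A'\<close> with values in \<open>V\<close>, where \<open>A'\<close> and \<open>B'\<close> have equal norms\<close>
  obtain g where g: "range g \<subseteq> V" "linear g" "\<And>y. A' (g y) = y"
    using linear_exists_right_inverse_on[OF A' V] surj by auto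
  define U where "U = B' \<circ> g"
  have "norm (U y) = norm y" for y
    using norm_eq[of "g y"] g(1,3) by (simp add: U_def image_subset_iff)
  then have "orthogonal_transformation U"
    using linear_compose[OF g(2) B'] by (simp add: orthogonal_transformation U_def)
  moreover have "U (A v) = B v" for v
  proof -
    have v: "(v, 0) \<in> V"
      by (simp add: V_def subspace_0 subspace_orthogonal_comp)
    have "norm (B' (g (A v) - (v, 0))) = norm (A' (g (A v) - (v, 0)))"
      using g(1) v by (intro norm_eq[symmetric] subspace_diff[OF V]) auto
    also have "\<dots> = 0"
      by (simp add: linear_diff[OF A'] g(3)) (simp add: A'_def)
    finally have "B' (g (A v)) = B' (v, 0)"
      by (simp add: linear_diff[OF B'])
    then show ?thesis
      by (simp add: U_def B'_def linear_0[OF j(1)])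
  qed
  ultimately show thesis by (rule that)
qed

text \<open>
  Since \<open>\<parallel>P\<^sup>T v\<parallel>\<^sup>2 = v \<bullet> P P\<^sup>T v\<close>, the transposes of both factors have equal norms on every vector, and an
  orthogonal map carries one to the other.
\<close>

lemma gram_eq_imp_orthogonal_factor:
  fixes P Q :: "real ^ 'k ^ 'n"
  assumes "P ** transpose P = Q ** transpose Q"
  obtains M :: "real ^ 'k ^ 'k" where "orthogonal_matrix M" and "P = Q ** M"
proof -
  have sq: "(norm (transpose R *v v))\<^sup>2 = v \<bullet> ((R ** transpose R) *v v)"
    for R :: "real ^ 'k ^ 'n" and v
    unfolding power2_norm_eq_inner
    by (metis dot_lmul_matrix matrix_vector_mul_assoc transpose_matrix_vector)
  have eq: "norm (transpose Q *v v) = norm (transpose P *v v)" for v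
  proof (rule power2_eq_imp_eq)
    show "(norm (transpose Q *v v))\<^sup>2 = (norm (transpose P *v v))\<^sup>2"
      by (simp only: sq assms)
  qed simp_all
  obtain U where U: "orthogonal_transformation U"
      "\<And>v. U (transpose Q *v v) = transpose P *v v"
    using orthogonal_extension[OF matrix_vector_mul_linear matrix_vector_mul_linear eq] by blast
  have lin: "linear U" and orth: "orthogonal_matrix (matrix U)"
    using U(1) orthogonal_transformation_matrix by blast+
  have "(matrix U ** transpose Q) *v v = transpose P *v v" for v
    by (simp only: matrix_vector_mul_assoc[symmetric] matrix_works[OF lin[folded linear_matrix_vector_mul_eq]] U(2))
  then have "matrix U ** transpose Q = transpose P"
    unfolding matrix_eq by blast
  then have "transpose (matrix U ** transpose Q) = P"
    by simp
  then have "P = Q ** transpose (matrix U)"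
    by (simp add: matrix_transpose_mul)
  moreover have "orthogonal_matrix (transpose (matrix U))"
    using orth by (simp add: orthogonal_matrix_transpose)
  ultimately show thesis
    using that by blast
qed

lemma gram_mult_orthogonal_matrix:
  fixes P :: "real ^ 'k ^ 'n"
  assumes "orthogonal_matrix M"
  shows "(P ** M) ** transpose (P ** M) = P ** transpose P"
proof -
  have "(P ** M) ** transpose (P ** M) = P ** (M ** transpose M) ** transpose P"
    by (simp add: matrix_transpose_mul matrix_mul_assoc)
  then show ?thesis
    using assms by (simp add: orthogonal_matrix_def)
qed

section \<open>Lifting convergent sequences to their factors\<close>

lemma continuous_on_matrix_mult [continuous_intros]:
  fixes F :: "'a::topological_space \<Rightarrow> real ^ 'm ^ 'n" and G :: "'a \<Rightarrow> real ^ 'p ^ 'm"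
  assumes "continuous_on S F" and "continuous_on S G"
  shows "continuous_on S (\<lambda>x. F x ** G x)"
  unfolding matrix_matrix_mult_def by (intro continuous_intros assms)

lemma continuous_on_gram:
  "continuous_on S (\<lambda>P :: real ^ 'k ^ 'n. P ** transpose P)"
  unfolding transpose_def by (intro continuous_intros)

text \<open>
  The diagonal entries of \<open>P P\<^sup>T\<close> are the squared norms of the rows of \<open>P\<close>; in particular bounded
  sets have bounded preimages under \<open>P \<mapsto> P P\<^sup>T\<close>.
\<close>

lemma norm_le_norm_gram:
  fixes P :: "real ^ 'k ^ 'n"
  shows "norm P \<le> CARD('n) * sqrt (norm (P ** transpose P))"
proof -
  have "norm (P $ i) \<le> sqrt (norm (P ** transpose P))" for i
  proof (rule real_le_rsqrt)
    have "(norm (P $ i))\<^sup>2 = (P ** transpose P) $ i $ i"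
      by (simp add: matrix_mult_transpose_dot_row row_def power2_norm_eq_inner)
    also have "\<dots> \<le> norm ((P ** transpose P) $ i)"
      using Finite_Cartesian_Product.norm_nth_le[of "(P ** transpose P) $ i" i] by simp
    also have "\<dots> \<le> norm (P ** transpose P)"
      by (rule Finite_Cartesian_Product.norm_nth_le)
    finally show "(norm (P $ i))\<^sup>2 \<le> norm (P ** transpose P)" .
  qed
  then have "(\<Sum>i\<in>UNIV. norm (P $ i)) \<le> CARD('n) * sqrt (norm (P ** transpose P))"
    by (rule sum_bounded_above)
  moreover have "norm P \<le> (\<Sum>i\<in>UNIV. norm (P $ i))"
    by (simp add: norm_vec_def L2_set_le_sum)
  ultimately show ?thesis by linarith
qed

text \<open>
  Compactness yields convergent factors with an uncontrolled limit \<open>L\<close>; right multiplication by the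
  orthogonal matrix that turns \<open>L\<close> into \<open>P\<close> moves the limit to the prescribed \<open>P\<close> and leaves the
  products unchanged.
\<close>

lemma gram_sequence_lift:
  fixes P :: "real ^ 'k ^ 'n"
  assumes X: "\<And>m. X m \<in> feasible_A CARD('k)" and lim: "X \<longlonglongrightarrow> P ** transpose P"
  obtains r and R :: "nat \<Rightarrow> real ^ 'k ^ 'n"
  where "strict_mono r" and "\<And>m. R m ** transpose (R m) = X (r m)" and "R \<longlonglongrightarrow> P"
proof -
  have "\<exists>Q :: real ^ 'k ^ 'n. Q ** transpose Q = X m" for m
    using psd_low_rank_factorization[OF X] by blast
  then obtain Q :: "nat \<Rightarrow> real ^ 'k ^ 'n" where Q: "\<And>m. Q m ** transpose (Q m) = X m"
    by metis
  obtain K where K: "\<And>m. norm (X m) \<le> K"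
    using convergent_imp_bounded[OF lim] by (auto simp: bounded_iff)
  have "norm (Q m) \<le> CARD('n) * sqrt K" for m
    using norm_le_norm_gram[of "Q m"] K[of m] unfolding Q
    by (meson mult_left_mono of_nat_0_le_iff order_trans real_sqrt_le_mono)
  then have "bounded (range Q)"
    by (auto simp: bounded_iff)
  then obtain L r where r: "strict_mono r" and L: "(Q \<circ> r) \<longlonglongrightarrow> L"
    using bounded_imp_convergent_subsequence by blast
  have "(\<lambda>m. Q (r m) ** transpose (Q (r m))) \<longlonglongrightarrow> L ** transpose L"
    using continuous_on_tendsto_compose[OF continuous_on_gram[of UNIV] L] by simp
  moreover have "(\<lambda>m. Q (r m) ** transpose (Q (r m))) \<longlonglongrightarrow> P ** transpose P"
    using LIMSEQ_subseq_LIMSEQ[OF lim r] by (simp add: Q o_def)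
  ultimately have "P ** transpose P = L ** transpose L"
    using LIMSEQ_unique by blast
  then obtain M where M: "orthogonal_matrix M" "P = L ** M"
    using gram_eq_imp_orthogonal_factor by blast
  have "continuous_on UNIV (\<lambda>N :: real ^ 'k ^ 'n. N ** M)"
    by (intro continuous_intros)
  then have "(\<lambda>m. Q (r m) ** M) \<longlonglongrightarrow> P"
    using continuous_on_tendsto_compose[OF _ L] M(2) by fastforce
  then show thesis
    by (rule that[OF r, rotated]) (simp only: gram_mult_orthogonal_matrix[OF M(1)] Q)
qed

section \<open>Equivalence of local minimality\<close>

theorem theorem1:
  fixes f :: "real ^ 'n ^ 'n \<Rightarrow> ereal"
    and Pbar :: "real ^ 'k ^ 'n"
    and Xbar :: "real ^ 'n ^ 'n"
  assumes "lower_semicontinuous f"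
    and "\<exists>X. psd X \<and> f X < \<infinity>"
    and "Xbar = Pbar ** transpose Pbar"
    and "Xbar \<in> feasible_A CARD('k)"
  shows "local_minimizer (feasible_A CARD('k)) f Xbar \<longleftrightarrow>
         local_minimizer UNIV (objective_B f) Pbar"
proof
  assume "local_minimizer (feasible_A CARD('k)) f Xbar"
  then obtain \<epsilon> where \<epsilon>: "\<epsilon> > 0"
    and min: "\<And>Y. Y \<in> feasible_A CARD('k) \<Longrightarrow> dist Xbar Y \<le> \<epsilon> \<Longrightarrow> \<not> f Y < f Xbar"
    unfolding local_minimizer_def by blast
  obtain \<delta> where \<delta>: "\<delta> > 0"
    and near: "\<And>P. dist P Pbar < \<delta> \<Longrightarrow> dist (P ** transpose P) Xbar < \<epsilon>"
    using continuous_on_gram[of UNIV] \<epsilon> assms(3) unfolding continuous_on_iff by blast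
  \<comment> \<open>local minimality uses closed balls, continuity open ones; hence the halved radius\<close>
  have "\<not> objective_B f P < objective_B f Pbar" if "dist Pbar P \<le> \<delta> / 2" for P
    using min[OF gram_feasible[of P]] near[of P] that \<delta> assms(3)
    by (simp add: objective_B_def dist_commute)
  moreover have "\<delta> / 2 > 0"
    using \<delta> by simp
  ultimately show "local_minimizer UNIV (objective_B f) Pbar"
    unfolding local_minimizer_def by blast
next
  assume "local_minimizer UNIV (objective_B f) Pbar"
  then obtain \<epsilon> where \<epsilon>: "\<epsilon> > 0"
    and min: "\<And>P. dist Pbar P \<le> \<epsilon> \<Longrightarrow> \<not> f (P ** transpose P) < f Xbar"
    unfolding local_minimizer_def objective_B_def assms(3) by blast
  show "local_minimizer (feasible_A CARD('k)) f Xbar"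
  proof (rule ccontr)
    assume "\<not> local_minimizer (feasible_A CARD('k)) f Xbar"
    then have "\<exists>Y. Y \<in> feasible_A CARD('k) \<and> dist Xbar Y \<le> inverse (Suc m) \<and> f Y < f Xbar"
      for m :: nat
    proof -
      have "inverse (real (Suc m)) > 0" by simp
      with \<open>\<not> local_minimizer (feasible_A CARD('k)) f Xbar\<close> show ?thesis
        using assms(4) unfolding local_minimizer_def by blast
    qed
    then obtain X where X: "\<And>m. X m \<in> feasible_A CARD('k)"
      and close: "\<And>m :: nat. dist Xbar (X m) \<le> inverse (Suc m)" and less: "\<And>m. f (X m) < f Xbar"
      by metis
    have "(\<lambda>m. dist (X m) Xbar) \<longlonglongrightarrow> 0"
      by (rule tendsto_sandwich[OF _ _ tendsto_const LIMSEQ_inverse_real_of_nat])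
        (use close in \<open>auto simp: dist_commute\<close>)
    then have "X \<longlonglongrightarrow> Pbar ** transpose Pbar"
      using assms(3) tendsto_dist_iff by blast
    then obtain r and R :: "nat \<Rightarrow> real ^ 'k ^ 'n"
      where R: "\<And>m. R m ** transpose (R m) = X (r m)" and lim: "R \<longlonglongrightarrow> Pbar"
      using gram_sequence_lift[where X = X, OF X] by blast
    obtain m where "dist (R m) Pbar < \<epsilon>"
      using metric_LIMSEQ_D[OF lim \<epsilon>] by blast
    then show False
      using min[of "R m"] R[of m] less[of "r m"] by (simp add: dist_commute)
  qed
qed

end
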